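(* For any positive integers $k$ and $b$ with $b\ge \frac{k}{2}$, there exists a graph $G^k_b$ such that $b_t^k(G^k_b)=b$.
   Context: All graphs are finite, simple, undirected, without isolated vertices. A total dominating set of a graph without isolated vertices is a vertex set $S$ such that every vertex is adjacent to some vertex of $S$; $\gamma_t(G)$ is the minimum size of such a set. The $k$-total bondage number $b_t^k(G)$ is the minimum number of edges that must be deleted from $G$ so that the resulting graph (required to have no isolated vertices) has total domination number at least $\gamma_t(G)+k$. *)

theory Defs
  imports Complex_Main "HOL-Library.Extended_Nat"
begin

text \<open>A graph is given by a vertex set \<open>V\<close> and a set \<open>E\<close> of two-element subsets of \<open>V\<close>.\<close>

definition simple_graph :: "'a set \<Rightarrow> 'a set set \<Rightarrow> bool" where
  "simple_graph V E \<longleftrightarrow> finite V \<and> (\<forall>e\<in>E. e \<subseteq> V \<and> card e = 2)"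

definition adjacent :: "'a set set \<Rightarrow> 'a \<Rightarrow> 'a \<Rightarrow> bool" where
  "adjacent E u v \<longleftrightarrow> {u, v} \<in> E"

definition no_isolated_vertices :: "'a set \<Rightarrow> 'a set set \<Rightarrow> bool" where
  "no_isolated_vertices V E \<longleftrightarrow> (\<forall>v\<in>V. \<exists>u\<in>V. adjacent E v u)"

definition total_dominating_set :: "'a set \<Rightarrow> 'a set set \<Rightarrow> 'a set \<Rightarrow> bool" where
  "total_dominating_set V E S \<longleftrightarrow> S \<subseteq> V \<and> (\<forall>v\<in>V. \<exists>u\<in>S. adjacent E v u)"

text \<open>If the graph has no isolated vertices, \<open>V\<close> itself is total dominating, so the infimum
  below is a minimum; it has no meaning otherwise.\<close>

definition total_domination_number :: "'a set \<Rightarrow> 'a set set \<Rightarrow> nat" where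
  "total_domination_number V E = Inf {card S | S. total_dominating_set V E S}"

text \<open>The value is \<open>\<infinity>\<close> exactly if no admissible edge deletion raises the total domination
  number by at least \<open>k\<close>.\<close>

definition total_bondage_number :: "nat \<Rightarrow> 'a set \<Rightarrow> 'a set set \<Rightarrow> enat" where
  "total_bondage_number k V E =
     Inf {enat (card F) | F. F \<subseteq> E \<and> no_isolated_vertices V (E - F) \<and>
            total_domination_number V (E - F) \<ge> total_domination_number V E + k}"

end

theory Submission
  imports Defs
begin

text \<open>
  Attach a pendant vertex to every vertex of a graph \<open>X\<close> on \<open>n\<close> vertices. Every total dominating
  set of the resulting corona contains all of \<open>X\<close>, and it must contain the pendant of \<open>x\<close> exactly
  when \<open>x\<close> is isolated in \<open>X\<close>; hence the total domination number is \<open>n\<close> plus the number of isolated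
  vertices of \<open>X\<close>. Pendant edges may not be deleted, so the \<open>k\<close>-total bondage number of the corona
  of a graph \<open>X\<close> without isolated vertices is the least number of edges whose deletion isolates \<open>k\<close>
  vertices of \<open>X\<close>. Take for \<open>X\<close> a clique on \<open>b + 2\<close> vertices together with \<open>k\<close> further vertices that
  are covered by, and meet all of, \<open>b\<close> additional edges: isolating a clique vertex costs \<open>b + 1\<close>
  deletions, and isolating all the other vertices costs exactly \<open>b\<close>. The condition \<open>b \<ge> k / 2\<close> is
  what makes it possible to cover \<open>k\<close> vertices by \<open>b\<close> edges.
\<close>

definition isolated_vertices :: "'a set \<Rightarrow> 'a set set \<Rightarrow> 'a set" where
  "isolated_vertices X D = {v \<in> X. \<forall>u. {v, u} \<notin> D}"

text \<open>The pendant of \<open>v < n\<close> is encoded as \<open>v + n\<close>, so the corona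
  has vertex set \<open>{..<2 * n}\<close>.\<close>

definition pendant_edges :: "nat \<Rightarrow> nat set set" where
  "pendant_edges n = (\<lambda>v. {v, v + n}) ` {..<n}"

lemma total_domination_number_eqI:
  assumes "total_dominating_set V E S"
    and "\<And>T. total_dominating_set V E T \<Longrightarrow> card S \<le> card T"
  shows "total_domination_number V E = card S"
  unfolding total_domination_number_def
  using assms by (intro cInf_eq_minimum) auto

lemma pendant_edge_iff:
  assumes "D \<subseteq> Pow {..<n}" "v < n"
  shows "{v + n, u} \<in> D \<union> pendant_edges n \<longleftrightarrow> u = v"
  using assms by (auto simp: pendant_edges_def doubleton_eq_iff)

lemma base_edge_iff:
  assumes "D \<subseteq> Pow {..<n}" "v < n"
  shows "{v, u} \<in> D \<union> pendant_edges n \<longleftrightarrow> {v, u} \<in> D \<or> u = v + n"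
  using assms by (auto simp: pendant_edges_def doubleton_eq_iff)

lemma lessThan_double_cases:
  assumes "(v :: nat) < 2 * n"
  obtains "v < n" | w where "w < n" "v = w + n"
proof (cases "v < n")
  case False
  then show ?thesis using assms that(2)[of "v - n"] by simp
qed (use that in blast)

text \<open>The only neighbour of \<open>v + n\<close> is \<open>v\<close>, and the only neighbour
  of an isolated \<open>v\<close> is \<open>v + n\<close>. Hence \<open>?S\<close> lies in every
  total dominating set, and it is one itself.\<close>

lemma total_domination_number_corona:
  assumes D: "D \<subseteq> Pow {..<n}"
  shows "total_domination_number {..<2 * n} (D \<union> pendant_edges n)
           = n + card (isolated_vertices {..<n} D)"
proof -
  let ?I = "isolated_vertices {..<n} D"
  let ?E = "D \<union> pendant_edges n"
  let ?S = "{..<n} \<union> (\<lambda>v. v + n) ` ?I"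
  have I: "?I \<subseteq> {..<n}" by (auto simp: isolated_vertices_def)
  then have finI: "finite ?I" using finite_subset by blast
  have card_S: "card ?S = n + card ?I"
    using finI by (subst card_Un_disjoint) (auto simp: card_image)
  have "\<exists>u\<in>?S. {v, u} \<in> ?E" if "v < 2 * n" for v
    using that
  proof (cases rule: lessThan_double_cases)
    case 1
    show ?thesis
    proof (cases "v \<in> ?I")
      case True
      then show ?thesis using base_edge_iff[OF D 1] by blast
    next
      case False
      then obtain u where "{v, u} \<in> D" using 1 by (auto simp: isolated_vertices_def)
      moreover from this have "u < n" using D by auto
      ultimately show ?thesis by blast
    qed
  next
    case (2 w)
    then show ?thesis using pendant_edge_iff[OF D, of w w] by blast
  qed
  then have tds: "total_dominating_set {..<2 * n} ?E ?S"
    using I by (fastforce simp: total_dominating_set_def adjacent_def)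
  have "?S \<subseteq> T" and "finite T" if T: "total_dominating_set {..<2 * n} ?E T" for T
  proof -
    have dom: "\<exists>u\<in>T. {v, u} \<in> ?E" if "v < 2 * n" for v
      using T that by (auto simp: total_dominating_set_def adjacent_def)
    have "v \<in> T" if "v < n" for v
      using dom[of "v + n"] pendant_edge_iff[OF D that] that by auto
    moreover have "v + n \<in> T" if "v \<in> ?I" for v
      using dom[of v] base_edge_iff[OF D, of v] that by (auto simp: isolated_vertices_def)
    ultimately show "?S \<subseteq> T" by auto
    show "finite T" using T finite_subset by (auto simp: total_dominating_set_def)
  qed
  then show ?thesis
    using total_domination_number_eqI[OF tds] card_mono card_S by metis
qed

text \<open>Deleting a pendant edge isolates its pendant vertex; conversely, the pendant edges alone
  give every vertex a neighbour.\<close>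

lemma no_isolated_vertices_corona_iff:
  assumes D: "D \<subseteq> Pow {..<n}"
  shows "no_isolated_vertices {..<2 * n} (D \<union> pendant_edges n - F)
           \<longleftrightarrow> F \<inter> pendant_edges n = {}"
proof
  assume niv: "no_isolated_vertices {..<2 * n} (D \<union> pendant_edges n - F)"
  have "{v, v + n} \<notin> F" if "v < n" for v
  proof -
    have "v + n \<in> {..<2 * n}" using that by simp
    with niv obtain u where "{v + n, u} \<in> D \<union> pendant_edges n - F"
      unfolding no_isolated_vertices_def adjacent_def by blast
    with pendant_edge_iff[OF D that] show ?thesis by (auto simp: insert_commute)
  qed
  then show "F \<inter> pendant_edges n = {}" by (auto simp: pendant_edges_def)
next
  assume F: "F \<inter> pendant_edges n = {}"
  have edge: "{v, v + n} \<in> D \<union> pendant_edges n - F" if "v < n" for v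
    using that F by (auto simp: pendant_edges_def)
  have "\<exists>u\<in>{..<2 * n}. {v, u} \<in> D \<union> pendant_edges n - F" if "v < 2 * n" for v
    using that
  proof (cases rule: lessThan_double_cases)
    case 1
    then show ?thesis using edge[of v] by (intro bexI[of _ "v + n"]) auto
  next
    case (2 w)
    then show ?thesis using edge[of w]
      by (intro bexI[of _ w]) (auto simp: insert_commute)
  qed
  then show "no_isolated_vertices {..<2 * n} (D \<union> pendant_edges n - F)"
    by (auto simp: no_isolated_vertices_def adjacent_def)
qed

text \<open>Admissible deletions avoid the pendant edges, so they lie inside \<open>D\<close>. The
  summand \<open>n\<close> then cancels, and \<open>iso\<close> makes the initial count of isolated
  vertices zero.\<close>

lemma total_bondage_number_corona:
  assumes D: "D \<subseteq> Pow {..<n}"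
    and iso: "isolated_vertices {..<n} D = {}"
  shows "total_bondage_number k {..<2 * n} (D \<union> pendant_edges n)
           = Inf {enat (card F) | F. F \<subseteq> D \<and> k \<le> card (isolated_vertices {..<n} (D - F))}"
proof -
  have disj: "D \<inter> pendant_edges n = {}"
    using D by (auto simp: pendant_edges_def)
  have "F \<subseteq> D \<union> pendant_edges n \<and> no_isolated_vertices {..<2 * n} (D \<union> pendant_edges n - F) \<and>
      total_domination_number {..<2 * n} (D \<union> pendant_edges n - F)
        \<ge> total_domination_number {..<2 * n} (D \<union> pendant_edges n) + k
    \<longleftrightarrow> F \<subseteq> D \<and> k \<le> card (isolated_vertices {..<n} (D - F))" for F
  proof (cases "F \<subseteq> D")
    case True
    then have "D \<union> pendant_edges n - F = (D - F) \<union> pendant_edges n"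
      and "F \<inter> pendant_edges n = {}"
      using disj by auto
    moreover have "D - F \<subseteq> Pow {..<n}" using D by blast
    ultimately show ?thesis
      using True no_isolated_vertices_corona_iff[OF D, of F]
        total_domination_number_corona[OF D] total_domination_number_corona[of "D - F" n] iso
      by auto
  next
    case False
    then show ?thesis using no_isolated_vertices_corona_iff[OF D, of F] by blast
  qed
  then show ?thesis unfolding total_bondage_number_def by simp
qed

text \<open>Covering \<open>{..<k}\<close> makes deletion of \<open>A\<close> isolate these
  vertices; since every edge of \<open>A\<close> meets \<open>{..<k}\<close>, isolating all of them
  requires deleting the whole of \<open>A\<close>.\<close>

lemma ex_edge_cover:
  fixes k b :: nat
  assumes "k > 0" "k \<le> 2 * b"
  obtains A :: "nat set set" where "card A = b" "finite A" "{..<k} \<subseteq> \<Union>A"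
    "\<And>e. e \<in> A \<Longrightarrow> e \<subseteq> {..<k + b + 2} \<and> card e = 2 \<and> e \<inter> {..<k} \<noteq> {}"
proof -
  \<comment> \<open>This is \<open>k / 2\<close> rounded up, the number of pairs that cover
    \<open>k\<close> vertices.\<close>
  define c where "c = (k + 1) div 2"
  have c: "c \<le> b" "0 < c" using assms by (auto simp: c_def)
  \<comment> \<open>For odd \<open>k\<close> the last pair contains the vertex \<open>k\<close>,
    which lies outside \<open>{..<k}\<close>.\<close>
  define M where "M = (\<lambda>i::nat. {2 * i, 2 * i + 1}) ` {..<c}"
  \<comment> \<open>Padding up to exactly \<open>b\<close> edges. Starting at \<open>k + 1\<close>
    rather than \<open>k\<close> avoids the edge \<open>{0, 1}\<close> of \<open>M\<close> when
    \<open>k = 1\<close>.\<close>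
  define R where "R = (\<lambda>i. {0, k + 1 + i}) ` {..<b - c}"
  have "card M = c"
    unfolding M_def by (subst card_image) (auto simp: inj_on_def doubleton_eq_iff)
  moreover have "card R = b - c"
    unfolding R_def by (subst card_image) (auto simp: inj_on_def doubleton_eq_iff)
  moreover have "M \<inter> R = {}"
    using assms by (auto simp: M_def R_def doubleton_eq_iff)
  moreover have fin: "finite M" "finite R" by (auto simp: M_def R_def)
  ultimately have "card (M \<union> R) = b" using c by (simp add: card_Un_disjoint)
  moreover have "{..<k} \<subseteq> \<Union>(M \<union> R)"
  proof
    fix v assume "v \<in> {..<k}"
    then have "v div 2 < c" by (auto simp: c_def)
    moreover have "v \<in> {2 * (v div 2), 2 * (v div 2) + 1}" by auto
    ultimately show "v \<in> \<Union>(M \<union> R)" unfolding M_def by blast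
  qed
  moreover have "e \<subseteq> {..<k + b + 2} \<and> card e = 2 \<and> e \<inter> {..<k} \<noteq> {}" if "e \<in> M \<union> R" for e
    using that
  proof
    assume "e \<in> M"
    then obtain i where i: "i < c" "e = {2 * i, 2 * i + 1}" by (auto simp: M_def)
    then have "2 * i < k" by (auto simp: c_def)
    then show ?thesis using i by auto
  next
    assume "e \<in> R"
    then obtain i where i: "i < b - c" "e = {0, k + 1 + i}" by (auto simp: R_def)
    then show ?thesis using assms by auto
  qed
  ultimately show ?thesis using that[of "M \<union> R"] fin by blast
qed

theorem theorem4p1:
  fixes k b :: nat
  assumes "k > 0" and "b > 0" and "real b \<ge> real k / 2"
  shows "\<exists>(V :: nat set) (E :: nat set set).
           simple_graph V E \<and> no_isolated_vertices V E \<and>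
           total_bondage_number k V E = enat b"
proof -
  define n where "n = k + b + 2"
  have "k \<le> 2 * b" using assms(3) by linarith
  with assms(1) obtain A :: "nat set set" where A: "card A = b" "finite A" "{..<k} \<subseteq> \<Union>A"
    and A_edge: "\<And>e. e \<in> A \<Longrightarrow> e \<subseteq> {..<n} \<and> card e = 2 \<and> e \<inter> {..<k} \<noteq> {}"
    unfolding n_def using ex_edge_cover by metis
  \<comment> \<open>Edges of \<open>A\<close> may end in the clique \<open>{k..<n}\<close>, but none
    lies inside it, so deleting \<open>A\<close> leaves the clique intact.\<close>
  define D where "D = A \<union> {e. e \<subseteq> {k..<n} \<and> card e = 2}"
  let ?iso = "isolated_vertices {..<n}"
  have D: "D \<subseteq> Pow {..<n}" "\<And>e. e \<in> D \<Longrightarrow> card e = 2"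
    using A_edge by (auto simp: D_def)
  have finD: "finite D" using D(1) finite_subset by blast
  have clique_edge: "{v, u} \<in> D" if "v \<in> {k..<n}" "u \<in> {k..<n} - {v}" for u v
    using that by (auto simp: D_def)
  have A_edge_at: "\<exists>u. {v, u} \<in> A" if "v < k" for v
  proof -
    from A(3) that obtain e where e: "e \<in> A" "v \<in> e" by blast
    then have "card e = 2" using A_edge by blast
    then obtain x y where "e = {x, y}" by (auto simp: card_2_iff)
    then have "e = {v, x} \<or> e = {v, y}" using e(2) by auto
    then show ?thesis using e(1) by blast
  qed
  have clique_degree: "card ({k..<n} - {v}) = b + 1" if "v \<in> {k..<n}" for v
    using that by (simp add: n_def)
  have iso_D: "?iso D = {}"
  proof -
    have "\<exists>u. {v, u} \<in> D" if "v < n" for v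
    proof (cases "v < k")
      case True
      then show ?thesis using A_edge_at by (auto simp: D_def)
    next
      case False
      then have v: "v \<in> {k..<n}" using that by simp
      then have "{k..<n} - {v} \<noteq> {}" using clique_degree[OF v]
        by (metis add_is_0 card.empty one_neq_zero)
      then show ?thesis using clique_edge[OF v] by blast
    qed
    then show ?thesis by (auto simp: isolated_vertices_def)
  qed
  have lower: "b \<le> card F" if F: "F \<subseteq> D" "k \<le> card (?iso (D - F))" for F
  proof -
    have finF: "finite F" using F(1) finD finite_subset by blast
    show ?thesis
    \<comment> \<open>An isolated clique vertex already accounts for \<open>b + 1\<close> edges of
      \<open>F\<close>. Otherwise only \<open>{..<k}\<close> can supply the \<open>k\<close>
      isolated vertices, so all of it is isolated.\<close>
    proof (cases "\<exists>v \<in> {k..<n}. v \<in> ?iso (D - F)")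
      case True
      then obtain v where v: "v \<in> {k..<n}" "v \<in> ?iso (D - F)" by blast
      have "(\<lambda>u. {v, u}) ` ({k..<n} - {v}) \<subseteq> F"
        using v(2) clique_edge[OF v(1)] unfolding isolated_vertices_def by blast
      then have "card ((\<lambda>u. {v, u}) ` ({k..<n} - {v})) \<le> card F"
        using finF card_mono by blast
      moreover have "inj_on (\<lambda>u. {v, u}) ({k..<n} - {v})"
        by (auto simp: inj_on_def doubleton_eq_iff)
      ultimately show ?thesis using clique_degree[OF v(1)] by (simp add: card_image)
    next
      case False
      then have "?iso (D - F) \<subseteq> {..<k}" by (force simp: isolated_vertices_def)
      then have iso_eq: "?iso (D - F) = {..<k}"
        using F(2) by (intro card_seteq) auto
      have "A \<subseteq> F"
      proof
        fix e assume e: "e \<in> A"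
        then obtain v where v: "v \<in> e" "v < k" using A_edge by blast
        have "card e = 2" using A_edge e by blast
        then obtain x y where "e = {x, y}" by (auto simp: card_2_iff)
        then have "e = {v, x} \<or> e = {v, y}" using v(1) by auto
        then obtain u where "e = {v, u}" by blast
        moreover have "v \<in> ?iso (D - F)" using iso_eq v by simp
        ultimately show "e \<in> F" using e unfolding isolated_vertices_def D_def by blast
      qed
      then show ?thesis using A(1) finF card_mono by blast
    qed
  qed
  \<comment> \<open>The bound \<open>b\<close> is attained by deleting \<open>A\<close>: the
    remaining edges all lie inside the clique.\<close>
  have "{v, u} \<notin> D - A" if "v < k" for u v
    using that by (auto simp: D_def)
  then have "{..<k} \<subseteq> ?iso (D - A)"
    by (auto simp: isolated_vertices_def n_def)
  moreover have "finite (?iso (D - A))" by (simp add: isolated_vertices_def)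
  ultimately have "k \<le> card (?iso (D - A))" by (metis card_mono card_lessThan)
  moreover have "A \<subseteq> D" by (simp add: D_def)
  ultimately have "Inf {enat (card F) | F. F \<subseteq> D \<and> k \<le> card (?iso (D - F))} = enat b"
    using lower A(1) by (intro cInf_eq_minimum) (blast, fastforce)
  then have "total_bondage_number k {..<2 * n} (D \<union> pendant_edges n) = enat b"
    using total_bondage_number_corona[OF D(1) iso_D] by simp
  moreover have "no_isolated_vertices {..<2 * n} (D \<union> pendant_edges n)"
    using no_isolated_vertices_corona_iff[OF D(1), of "{}"] by simp
  moreover have "simple_graph {..<2 * n} (D \<union> pendant_edges n)"
    unfolding simple_graph_def
  proof (intro conjI ballI)
    fix e assume "e \<in> D \<union> pendant_edges n"
    then show "e \<subseteq> {..<2 * n}" and "card e = 2"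
      using D by (fastforce simp: pendant_edges_def)+
  qed simp
  ultimately show ?thesis by blast
qed

end
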